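(* Let $(K,d)$ be a complete metric space, $Y$ a complex Banach space and $A$ a (closed linear) subspace of $C_b(K,Y)$. Assume that there exist a norming subset $\{x_\alpha\}_\alpha\subset K$ for $A$ and a family $\{\varphi_\alpha\}_\alpha$ of functions in $C_b(K)$ such that each $\varphi_\alpha$ is a strong peak function at $x_\alpha$. Assume also that $A$ contains $\varphi_\alpha^n\otimes y$ for every $\alpha$, every $y\in Y$ and every integer $n\ge1$. Then the set of norm-attaining elements of $A$ is dense in $A$.
   Context: $C_b(K)$ is the complex Banach space of bounded continuous complex-valued functions on $K$ and $C_b(K,Y)$ the Banach space of bounded continuous functions $K\to Y$, both with the sup norm. "Subspace" means closed linear subspace. $(\varphi\otimes y)(x)=\varphi(x)y$. $F\subset K$ is a norming subset for $A$ if $\|f\|=\sup_{x\in F}\|f(x)\|$ for every $f\in A$. A nonzero $\varphi\in C_b(K)$ is a strong peak function at $x_0\in K$ if $x_0$ is the only point of $K$ with $|\varphi(x_0)|=\|\varphi\|$ and for every neighborhood $V$ of $x_0$ there is $\delta>0$ with $|\varphi(y)|\le\|\varphi\|-\delta$ for all $y\in K\setminus V$. An element $f\in A$ is norm-attaining if $\|f(x)\|=\|f\|$ for some $x\in K$. *)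

theory Defs
  imports "HOL-Analysis.Analysis"
begin

text \<open>
  HOL-Analysis has type classes for real normed spaces only. A complex normed space is a real one
  with a complex scalar multiplication that restricts to the real one and for which the norm
  is homogeneous.
\<close>

class complex_normed_vector = real_normed_vector +
  fixes scaleC :: "complex \<Rightarrow> 'a \<Rightarrow> 'a" (infixr \<open>*\<^sub>C\<close> 75)
  assumes scaleC_add_right: "c *\<^sub>C (x + y) = c *\<^sub>C x + c *\<^sub>C y"
    and scaleC_add_left: "(b + c) *\<^sub>C x = b *\<^sub>C x + c *\<^sub>C x"
    and scaleC_scaleC: "b *\<^sub>C (c *\<^sub>C x) = (b * c) *\<^sub>C x"
    and scaleC_of_real: "complex_of_real r *\<^sub>C x = r *\<^sub>R x"
    and norm_scaleC: "norm (c *\<^sub>C x) = cmod c * norm x"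

class complex_banach = complex_normed_vector + banach

global_interpretation complex_vector:
  vector_space "scaleC :: complex \<Rightarrow> 'a \<Rightarrow> 'a::complex_normed_vector"
proof
  show "1 *\<^sub>C x = x" for x :: 'a
    using scaleC_of_real[of 1 x] by simp
qed (simp_all add: scaleC_add_right scaleC_add_left scaleC_scaleC)

instantiation complex :: complex_banach
begin

definition scaleC_complex :: "complex \<Rightarrow> complex \<Rightarrow> complex"
  where "scaleC_complex = (*)"

instance
  by standard (simp_all add: scaleC_complex_def algebra_simps norm_mult scaleR_conv_of_real)

end

lemma bounded_bilinear_scaleC:
  "bounded_bilinear (scaleC :: complex \<Rightarrow> 'a \<Rightarrow> 'a::complex_normed_vector)"
proof
  fix a a' :: complex and b b' :: 'a and r :: real
  show "(a + a') *\<^sub>C b = a *\<^sub>C b + a' *\<^sub>C b"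
    by (rule scaleC_add_left)
  show "a *\<^sub>C (b + b') = a *\<^sub>C b + a *\<^sub>C b'"
    by (rule scaleC_add_right)
  show "(r *\<^sub>R a) *\<^sub>C b = r *\<^sub>R (a *\<^sub>C b)"
    by (simp only: scaleR_conv_of_real scaleC_scaleC[symmetric] scaleC_of_real)
  show "a *\<^sub>C (r *\<^sub>R b) = r *\<^sub>R (a *\<^sub>C b)"
    by (simp add: scaleC_of_real[symmetric] scaleC_scaleC mult.commute)
  show "\<exists>K. \<forall>a b. norm (a *\<^sub>C b :: 'a) \<le> norm a * norm b * K"
    by (rule exI[of _ 1]) (simp add: norm_scaleC)
qed

lemma bounded_bilinear_bcontfun:
  fixes f :: "'k::topological_space \<Rightarrow>\<^sub>C 'a::real_normed_vector"
    and g :: "'k \<Rightarrow>\<^sub>C 'b::real_normed_vector"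
    and m :: "'a \<Rightarrow> 'b \<Rightarrow> 'c::real_normed_vector"
  assumes "bounded_bilinear m"
  shows "(\<lambda>x. m (f x) (g x)) \<in> bcontfun"
proof -
  interpret m: bounded_bilinear m by fact
  obtain M where M: "\<And>a b. norm (m a b) \<le> norm a * norm b * M" "0 < M"
    using m.pos_bounded by blast
  show ?thesis
  proof (rule bcontfun_normI)
    show "continuous_on UNIV (\<lambda>x. m (f x) (g x))"
      by (intro m.continuous_on) simp_all
    fix x
    have "norm (f x) * norm (g x) \<le> norm f * norm g"
      by (intro mult_mono norm_bounded) auto
    then show "norm (m (f x) (g x)) \<le> norm f * norm g * M"
      by (metis M mult_right_mono less_imp_le order_trans)
  qed
qed

definition tensor_bcontfun ::
    "('k::topological_space \<Rightarrow>\<^sub>C complex) \<Rightarrow> 'a::complex_normed_vector \<Rightarrow> ('k \<Rightarrow>\<^sub>C 'a)"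
    (infixr \<open>\<otimes>\<^sub>C\<close> 75)
  where "\<phi> \<otimes>\<^sub>C y = Bcontfun (\<lambda>x. apply_bcontfun \<phi> x *\<^sub>C y)"

lemma apply_tensor_bcontfun [simp]: "(\<phi> \<otimes>\<^sub>C y) x = \<phi> x *\<^sub>C y"
  using bounded_bilinear_bcontfun[OF bounded_bilinear_scaleC, of \<phi> "const_bcontfun y"]
  by (simp add: tensor_bcontfun_def Bcontfun_inverse)

instantiation bcontfun :: (topological_space, complex_normed_vector) complex_normed_vector
begin

definition scaleC_bcontfun :: "complex \<Rightarrow> ('a \<Rightarrow>\<^sub>C 'b) \<Rightarrow> ('a \<Rightarrow>\<^sub>C 'b)"
  where "c *\<^sub>C f = Bcontfun (\<lambda>x. c *\<^sub>C apply_bcontfun f x)"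

lemma apply_scaleC_bcontfun [simp]: "(c *\<^sub>C f) x = c *\<^sub>C f x"
  for f :: "'a \<Rightarrow>\<^sub>C 'b"
  using bounded_bilinear_bcontfun[OF bounded_bilinear_scaleC, of "const_bcontfun c" f]
  by (simp add: scaleC_bcontfun_def Bcontfun_inverse)

instance
proof
  fix b c :: complex and r :: real and f g :: "'a \<Rightarrow>\<^sub>C 'b"
  show "c *\<^sub>C (f + g) = c *\<^sub>C f + c *\<^sub>C g"
    by (rule bcontfun_eqI) (simp add: scaleC_add_right)
  show "(b + c) *\<^sub>C f = b *\<^sub>C f + c *\<^sub>C f"
    by (rule bcontfun_eqI) (simp add: scaleC_add_left)
  show "b *\<^sub>C (c *\<^sub>C f) = (b * c) *\<^sub>C f"
    by (rule bcontfun_eqI) (simp add: scaleC_scaleC)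
  show "complex_of_real r *\<^sub>C f = r *\<^sub>R f"
    by (rule bcontfun_eqI) (simp add: scaleC_of_real)
  have le: "norm (d *\<^sub>C h) \<le> cmod d * norm h" for d and h :: "'a \<Rightarrow>\<^sub>C 'b"
    by (rule norm_bound) (simp add: norm_scaleC mult_left_mono norm_bounded)
  show "norm (c *\<^sub>C f) = cmod c * norm f"
  proof (cases "c = 0")
    case True
    then show ?thesis using le[of 0 f] by simp
  next
    case False
    have "inverse c *\<^sub>C c *\<^sub>C f = f"
      using False complex_vector.scale_one
      by (intro bcontfun_eqI) (simp add: scaleC_scaleC)
    then have "norm f \<le> inverse (cmod c) * norm (c *\<^sub>C f)"
      using le[of "inverse c" "c *\<^sub>C f"] by (simp add: norm_inverse)
    then have "cmod c * norm f \<le> norm (c *\<^sub>C f)"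
      using False by (simp add: field_simps)
    then show ?thesis using le[of c f] by simp
  qed
qed

end

instance bcontfun :: (metric_space, complex_banach) complex_banach ..

text \<open>The pointwise product makes the powers of a scalar function available.\<close>

instantiation bcontfun :: (topological_space, real_normed_algebra_1) monoid_mult
begin

definition one_bcontfun :: "'a \<Rightarrow>\<^sub>C 'b"
  where "1 = const_bcontfun 1"

definition times_bcontfun :: "('a \<Rightarrow>\<^sub>C 'b) \<Rightarrow> ('a \<Rightarrow>\<^sub>C 'b) \<Rightarrow> ('a \<Rightarrow>\<^sub>C 'b)"
  where "f * g = Bcontfun (\<lambda>x. apply_bcontfun f x * apply_bcontfun g x)"

lemma apply_times_bcontfun [simp]: "(f * g) x = f x * g x"
  for f g :: "'a \<Rightarrow>\<^sub>C 'b"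
  using bounded_bilinear_bcontfun[OF bounded_bilinear_mult, of f g]
  by (simp add: times_bcontfun_def Bcontfun_inverse)

instance
  by standard (auto intro!: bcontfun_eqI simp: one_bcontfun_def mult.assoc)

end

lemma apply_power_bcontfun [simp]: "(f ^ n) x = f x ^ n"
  for f :: "'k::topological_space \<Rightarrow>\<^sub>C 'b::real_normed_algebra_1"
  by (induction n) (simp_all add: one_bcontfun_def)

definition norming_subset ::
    "('k::topological_space \<Rightarrow>\<^sub>C 'a::real_normed_vector) set \<Rightarrow> 'k set \<Rightarrow> bool"
  where "norming_subset A F \<longleftrightarrow> (\<forall>f\<in>A. norm f = (SUP x\<in>F. norm (apply_bcontfun f x)))"

text \<open>A neighborhood of \<open>x\<^sub>0\<close> is any set, open or not, with \<open>x\<^sub>0\<close> in its interior.\<close>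

definition strong_peak_function ::
    "('k::topological_space \<Rightarrow>\<^sub>C complex) \<Rightarrow> 'k \<Rightarrow> bool"
  where "strong_peak_function \<phi> x\<^sub>0 \<longleftrightarrow>
    \<phi> \<noteq> 0 \<and>
    (\<forall>x. cmod (apply_bcontfun \<phi> x) = norm \<phi> \<longleftrightarrow> x = x\<^sub>0) \<and>
    (\<forall>V. x\<^sub>0 \<in> interior V \<longrightarrow> (\<exists>\<delta>>0. \<forall>y\<in>UNIV - V. cmod (apply_bcontfun \<phi> y) \<le> norm \<phi> - \<delta>))"

definition norm_attaining ::
    "('k::topological_space \<Rightarrow>\<^sub>C 'a::real_normed_vector) \<Rightarrow> bool"
  where "norm_attaining f \<longleftrightarrow> (\<exists>x. norm (apply_bcontfun f x) = norm f)"

end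

theory Submission
  imports Defs
begin

text \<open>
  Call an element \<open>g\<close> of \<open>A\<close> localized at scale \<open>r\<close> if all points where \<open>g\<close> nearly attains its norm
  lie in one ball of radius \<open>r\<close>. For fixed \<open>r\<close> this is an open condition. It is also dense in \<open>A\<close>:
  at a point \<open>a\<close> of the norming set where \<open>f\<close> is almost maximal, add a high power of the peak
  function times a small vector pointing in the direction of \<open>f a\<close>; this raises the norm at \<open>a\<close>
  by a fixed amount and has almost no effect outside the ball around \<open>a\<close>. By Baire's theorem the
  functions localized at every scale are dense, and by completeness of \<open>K\<close> they attain their norm.
\<close>

definition localized :: "real \<Rightarrow> ('k::metric_space \<Rightarrow>\<^sub>C 'a::real_normed_vector) \<Rightarrow> bool"
  where "localized r g \<longleftrightarrow>
    (\<exists>a. \<exists>\<delta>>0. \<forall>z. norm g - \<delta> < norm (apply_bcontfun g z) \<longrightarrow> dist a z < r)"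

text \<open>The centre \<open>a\<close> of \<open>g\<close> also serves every \<open>h\<close>
  within \<open>\<delta> / 3\<close> of \<open>g\<close>. Passing from \<open>h\<close> to
  \<open>g\<close> moves both the norm and the value at \<open>z\<close> by less than
  \<open>\<delta> / 3\<close>, so a point within \<open>\<delta> / 3\<close> of the norm of
  \<open>h\<close> is within \<open>\<delta>\<close> of that of \<open>g\<close>.\<close>

lemma open_localized: "open {g :: 'k::metric_space \<Rightarrow>\<^sub>C 'a::real_normed_vector. localized r g}"
proof (unfold open_dist, safe)
  fix g :: "'k \<Rightarrow>\<^sub>C 'a" assume "localized r g"
  then obtain a \<delta> where \<delta>: "\<delta> > 0"
    and a: "\<And>z. norm g - \<delta> < norm (apply_bcontfun g z) \<Longrightarrow> dist a z < r"
    unfolding localized_def by blast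
  have "localized r h" if h: "dist h g < \<delta> / 3" for h
    unfolding localized_def
  proof (intro exI conjI allI impI)
    show "0 < \<delta> / 3" using \<delta> by simp
    fix z assume z: "norm h - \<delta> / 3 < norm (apply_bcontfun h z)"
    have "norm (apply_bcontfun h z - apply_bcontfun g z) \<le> norm (h - g)"
      using norm_bounded[of "h - g" z] by simp
    moreover have "norm g - norm h \<le> norm (h - g)"
      by (metis norm_minus_commute norm_triangle_ineq2)
    moreover have "norm (apply_bcontfun h z) - norm (apply_bcontfun g z)
        \<le> norm (apply_bcontfun h z - apply_bcontfun g z)"
      by (rule norm_triangle_ineq2)
    ultimately show "dist a z < r"
      using z h by (intro a) (simp add: dist_norm)
  qed
  then show "\<exists>e>0. \<forall>h. dist h g < e \<longrightarrow> h \<in> {g. localized r g}"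
    using \<delta> by (intro exI[of _ "\<delta> / 3"]) simp
qed

lemma exists_norm_gt:
  fixes g :: "'k::topological_space \<Rightarrow>\<^sub>C 'a::real_normed_vector"
  assumes "d > 0"
  obtains z where "norm g - d < norm (apply_bcontfun g z)"
proof -
  have "\<exists>z. norm g - d < norm (apply_bcontfun g z)"
    using assms norm_bound[of g "norm g - d"] by (rule_tac ccontr) (auto simp: not_less)
  then show thesis using that by blast
qed

text \<open>A maximizing sequence eventually enters the ball belonging to each scale, hence is
  Cauchy. Its limit exists by completeness, and \<open>g\<close> attains its norm there by
  continuity.\<close>

lemma norm_attaining_if_localized:
  fixes g :: "'k::complete_space \<Rightarrow>\<^sub>C 'a::real_normed_vector"
  assumes "\<And>n. localized (1 / real (Suc n)) g"
  shows "norm_attaining g"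
proof -
  obtain a \<delta> where \<delta>: "\<And>n. \<delta> n > 0"
    and a: "\<And>n z. norm g - \<delta> n < norm (apply_bcontfun g z) \<Longrightarrow> dist (a n) z < 1 / real (Suc n)"
    using assms unfolding localized_def by metis
  have "\<exists>z. norm g - 1 / real (Suc m) < norm (apply_bcontfun g z)" for m
    by (rule exists_norm_gt[of "1 / real (Suc m)" g]) auto
  then obtain z where z: "\<And>m. norm g - 1 / real (Suc m) < norm (apply_bcontfun g (z m))"
    by metis
  have lim0: "(\<lambda>m. 1 / real (Suc m)) \<longlonglongrightarrow> 0"
    using LIMSEQ_inverse_real_of_nat by (simp add: inverse_eq_divide)
  have ev: "\<forall>\<^sub>F m in sequentially. dist (a n) (z m) < 1 / real (Suc n)" for n
    using order_tendstoD(2)[OF lim0 \<delta>[of n]]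
  proof (eventually_elim)
    case (elim m)
    then show ?case using z[of m] by (intro a) linarith
  qed
  have "Cauchy z"
  proof (rule metric_CauchyI)
    fix e :: real assume "e > 0"
    then obtain n where n: "1 / real (Suc n) < e / 2"
      using reals_Archimedean[of "e / 2"] by (auto simp: inverse_eq_divide)
    obtain N where N: "\<And>m. m \<ge> N \<Longrightarrow> dist (a n) (z m) < 1 / real (Suc n)"
      using ev[of n] unfolding eventually_sequentially by blast
    have "dist (z i) (z j) < e" if "i \<ge> N" "j \<ge> N" for i j
      using N[OF that(1)] N[OF that(2)] n dist_triangle3[of "z i" "z j" "a n"] by linarith
    then show "\<exists>N. \<forall>m\<ge>N. \<forall>n\<ge>N. dist (z m) (z n) < e" by blast
  qed
  then obtain w where w: "z \<longlonglongrightarrow> w"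
    using Cauchy_convergent_iff convergent_def by blast
  have "(\<lambda>m. norm (apply_bcontfun g (z m))) \<longlonglongrightarrow> norm (apply_bcontfun g w)"
    by (intro tendsto_norm continuous_on_tendsto_compose[OF continuous_on_apply_bcontfun[of UNIV] w]) auto
  moreover have "(\<lambda>m. norm (apply_bcontfun g (z m))) \<longlonglongrightarrow> norm g"
  proof (rule tendsto_sandwich)
    show "(\<lambda>m. norm g - 1 / real (Suc m)) \<longlonglongrightarrow> norm g"
      using tendsto_diff[OF tendsto_const lim0, of "norm g"] by simp
    show "\<forall>\<^sub>F m in sequentially. norm g - 1 / real (Suc m) \<le> norm (apply_bcontfun g (z m))"
      using z by (simp add: less_imp_le)
  qed (auto simp: norm_bounded)
  ultimately show ?thesis
    unfolding norm_attaining_def using LIMSEQ_unique by blast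
qed

text \<open>Turns the additive gap of the peak function into a ratio \<open>q < 1\<close>, so that
  powers of the normalized function decay uniformly off the ball.\<close>

lemma strong_peak_function_off_ball:
  fixes \<phi> :: "'k::metric_space \<Rightarrow>\<^sub>C complex"
  assumes "strong_peak_function \<phi> a" and "r > 0"
  obtains q where "0 \<le> q" "q < 1"
    "\<And>z. r \<le> dist a z \<Longrightarrow> cmod (apply_bcontfun \<phi> z) \<le> q * norm \<phi>"
proof -
  have "a \<in> interior (ball a r)" using assms by (simp add: interior_open)
  then obtain \<delta> where \<delta>: "\<delta> > 0"
    "\<And>z. z \<notin> ball a r \<Longrightarrow> cmod (apply_bcontfun \<phi> z) \<le> norm \<phi> - \<delta>"
    using assms unfolding strong_peak_function_def by (metis DiffI UNIV_I)
  have "norm \<phi> > 0" using assms by (simp add: strong_peak_function_def)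
  show thesis
  proof
    \<comment> \<open>The maximum with 0 is there because \<open>\<delta>\<close> may exceed
      \<open>norm \<phi>\<close> when no point lies outside the ball.\<close>
    show "0 \<le> max 0 (1 - \<delta> / norm \<phi>)" "max 0 (1 - \<delta> / norm \<phi>) < 1"
      using \<delta> \<open>norm \<phi> > 0\<close> by auto
    fix z assume "r \<le> dist a z"
    then have "cmod (apply_bcontfun \<phi> z) \<le> norm \<phi> - \<delta>" using \<delta>(2)[of z] by simp
    also have "\<dots> = (1 - \<delta> / norm \<phi>) * norm \<phi>"
      using \<open>norm \<phi> > 0\<close> by (simp add: field_simps)
    also have "\<dots> \<le> max 0 (1 - \<delta> / norm \<phi>) * norm \<phi>"
      by (intro mult_right_mono) auto
    finally show "cmod (apply_bcontfun \<phi> z) \<le> max 0 (1 - \<delta> / norm \<phi>) * norm \<phi>" .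
  qed
qed

text \<open>A nonnegative multiple of \<open>b\<close> adds its full length to the norm of
  \<open>b\<close>. The vector \<open>v\<close> only supplies a direction when
  \<open>b = 0\<close>.\<close>

lemma exists_aligned_vector:
  fixes b v :: "'a::real_normed_vector"
  assumes "v \<noteq> 0" and "0 \<le> e"
  obtains u where "norm u = e" "norm (b + u) = norm b + e"
proof (cases "b = 0")
  case True
  then show thesis using assms by (intro that[of "e *\<^sub>R sgn v"]) (auto simp: norm_sgn)
next
  case False
  have "b + e *\<^sub>R sgn b = (1 + e / norm b) *\<^sub>R b"
    by (simp add: sgn_div_norm algebra_simps divide_inverse)
  then have "norm (b + e *\<^sub>R sgn b) = norm b + e"
    using False assms by (simp add: field_simps)
  then show thesis using False assms by (intro that[of "e *\<^sub>R sgn b"]) (auto simp: norm_sgn)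
qed

text \<open>The perturbation lifts the norm above \<open>norm f + 3 * e / 4\<close> at
  \<open>a\<close>, while off the ball the sum stays below or at \<open>norm f + e / 4\<close>.
  Hence all points within \<open>e / 4\<close> of the new norm lie in the ball around
  \<open>a\<close>.\<close>

lemma localized_peak_perturbation:
  fixes f :: "'k::metric_space \<Rightarrow>\<^sub>C 'y::complex_normed_vector" and v :: 'y
  assumes peak: "strong_peak_function \<phi> a"
    and near: "norm f - e / 4 < norm (apply_bcontfun f a)"
    and "0 < e" and "0 < r" and "v \<noteq> 0"
  obtains n y where "1 \<le> n" "norm ((\<phi> ^ n) \<otimes>\<^sub>C y) \<le> e" "localized r (f + (\<phi> ^ n) \<otimes>\<^sub>C y)"
proof -
  obtain q where q: "0 \<le> q" "q < 1"
    "\<And>z. r \<le> dist a z \<Longrightarrow> cmod (apply_bcontfun \<phi> z) \<le> q * norm \<phi>"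
    using strong_peak_function_off_ball[OF peak \<open>0 < r\<close>] by blast
  obtain u where u: "norm u = e" "norm (apply_bcontfun f a + u) = norm (apply_bcontfun f a) + e"
    using exists_aligned_vector[OF \<open>v \<noteq> 0\<close>] \<open>0 < e\<close> by (metis less_imp_le)
  have pos: "norm \<phi> > 0" and at: "cmod (apply_bcontfun \<phi> a) = norm \<phi>"
    using peak by (auto simp: strong_peak_function_def)
  then have nz: "apply_bcontfun \<phi> a \<noteq> 0" by auto
  obtain n0 where n0: "q ^ n0 < 1 / 4"
    using real_arch_pow_inv[of "1 / 4" q] q by auto
  define n where "n = Suc n0"
  have n: "q ^ n \<le> 1 / 4"
    using n0 q power_decreasing[of n0 n q] by (simp add: n_def)
  \<comment> \<open>Dividing by the power of the value of \<open>\<phi>\<close> at \<open>a\<close>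
    removes both its modulus and its phase, so \<open>h\<close> takes exactly the value
    \<open>u\<close> at \<open>a\<close>.\<close>
  define h where "h = (\<phi> ^ n) \<otimes>\<^sub>C (inverse (apply_bcontfun \<phi> a ^ n) *\<^sub>C u)"
  have h: "norm (apply_bcontfun h z) = (cmod (apply_bcontfun \<phi> z) / norm \<phi>) ^ n * e" for z
    by (simp add: h_def norm_scaleC norm_inverse norm_mult norm_power at u power_mult_distrib
        power_inverse divide_inverse)
  have ha: "apply_bcontfun h a = u"
    using nz by (simp add: h_def scaleC_scaleC complex_vector.scale_one)
  show thesis
  proof (rule that)
    show "1 \<le> n" by (simp add: n_def)
    show "norm ((\<phi> ^ n) \<otimes>\<^sub>C (inverse (apply_bcontfun \<phi> a ^ n) *\<^sub>C u)) \<le> e"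
      unfolding h_def[symmetric]
    proof (rule norm_bound)
      fix z
      have "(cmod (apply_bcontfun \<phi> z) / norm \<phi>) ^ n \<le> 1"
        using pos norm_bounded[of \<phi> z] by (intro power_le_one) auto
      then show "norm (apply_bcontfun h z) \<le> e"
        using \<open>0 < e\<close> by (simp add: h)
    qed
    have lower: "norm f + e - e / 4 < norm (f + h)"
      using near norm_bounded[of "f + h" a] by (simp add: ha u)
    have "dist a z < r" if z: "norm (f + h) - e / 4 < norm (apply_bcontfun (f + h) z)" for z
    proof (rule ccontr)
      assume "\<not> dist a z < r"
      then have "cmod (apply_bcontfun \<phi> z) / norm \<phi> \<le> q"
        using q(3)[of z] pos by (simp add: field_simps)
      then have "(cmod (apply_bcontfun \<phi> z) / norm \<phi>) ^ n \<le> 1 / 4"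
        using n power_mono[of "cmod (apply_bcontfun \<phi> z) / norm \<phi>" q n] by simp
      then have "norm (apply_bcontfun h z) \<le> e / 4"
        unfolding h using mult_right_mono[of _ "1 / 4" e] \<open>0 < e\<close> by fastforce
      moreover have "norm (apply_bcontfun (f + h) z)
          \<le> norm (apply_bcontfun f z) + norm (apply_bcontfun h z)"
        by (simp add: norm_triangle_ineq)
      ultimately show False
        using z lower norm_bounded[of f z] \<open>0 < e\<close> by linarith
    qed
    then show "localized r (f + (\<phi> ^ n) \<otimes>\<^sub>C (inverse (apply_bcontfun \<phi> a ^ n) *\<^sub>C u))"
      unfolding h_def[symmetric] localized_def using \<open>0 < e\<close>
      by (intro exI[of _ a] exI[of _ "e / 4"]) auto
  qed
qed

lemma norming_subset_exists_norm_gt: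
  assumes "norming_subset A F" and "F \<noteq> {}" and "f \<in> A" and "d > 0"
  obtains a where "a \<in> F" "norm f - d < norm (apply_bcontfun f a)"
proof -
  have "norm f - d < (SUP x\<in>F. norm (apply_bcontfun f x))"
    using assms by (simp add: norming_subset_def)
  moreover have "bdd_above ((\<lambda>x. norm (apply_bcontfun f x)) ` F)"
    by (rule bdd_aboveI2[of _ _ "norm f"]) (rule norm_bounded)
  ultimately show thesis
    using that less_cSUP_iff[OF assms(2)] by blast
qed

theorem theorem5p1:
  fixes A :: "('k::complete_space \<Rightarrow>\<^sub>C 'y::complex_banach) set"
    and I :: "'i set"
    and x :: "'i \<Rightarrow> 'k"
    and \<phi> :: "'i \<Rightarrow> ('k \<Rightarrow>\<^sub>C complex)"
  assumes "complex_vector.subspace A"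
    and "closed A"
    and "norming_subset A (x ` I)"
    and "\<And>\<alpha>. \<alpha> \<in> I \<Longrightarrow> strong_peak_function (\<phi> \<alpha>) (x \<alpha>)"
    and "\<And>\<alpha> y n. \<alpha> \<in> I \<Longrightarrow> 1 \<le> n \<Longrightarrow> (\<phi> \<alpha> ^ n) \<otimes>\<^sub>C y \<in> A"
  shows "A \<subseteq> closure {f \<in> A. norm_attaining f}"
\<comment> \<open>The perturbation needs a peak point and a nonzero direction. If either is missing,
  every element of \<open>A\<close> is 0.\<close>
proof (cases "I \<noteq> {} \<and> (\<exists>v::'y. v \<noteq> 0)")
  case False
  have "norm f = 0" if "f \<in> A" for f
  proof (cases "I = {}")
    case True
    \<comment> \<open>The supremum over the empty set takes an unspecified value, equal to the norm of
      every element of \<open>A\<close>, in particular to that of \<open>0\<close>.\<close>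
    have "norm g = Sup {}" if "g \<in> A" for g
      using assms(3) True that by (simp add: norming_subset_def)
    from this[OF that] this[OF complex_vector.subspace_0[OF assms(1)]] show ?thesis by simp
  next
    case I: False
    then have "(v::'y) = 0" for v using False by blast
    then have "f = 0" by (intro bcontfun_eqI) metis
    then show ?thesis by simp
  qed
  \<comment> \<open>Types are inhabited, so \<open>undefined\<close> is a point of the space, and
    the zero function attains its norm there.\<close>
  moreover have "norm_attaining f" if "norm f = 0" for f :: "'k \<Rightarrow>\<^sub>C 'y"
    using that norm_bounded[of f undefined] unfolding norm_attaining_def by auto
  ultimately have "A \<subseteq> {f \<in> A. norm_attaining f}" by blast
  then show ?thesis using closure_subset by blast
next
  case True
  then obtain v :: 'y where v: "v \<noteq> 0" and I: "I \<noteq> {}" by blast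
  define G :: "nat \<Rightarrow> ('k \<Rightarrow>\<^sub>C 'y) set"
    where "G k = A \<inter> {g. localized (1 / real (Suc k)) g}" for k
  have dense: "A \<subseteq> closure (G k)" for k
  proof
    fix f assume f: "f \<in> A"
    show "f \<in> closure (G k)"
      unfolding closure_approachable
    proof (intro allI impI)
      fix e :: real assume e: "e > 0"
      \<comment> \<open>The perturbation gets size \<open>e / 2\<close>, which keeps the distance to
        \<open>f\<close> strictly below \<open>e\<close>; its lemma then asks for a point within a
        quarter of that size.\<close>
      obtain \<alpha> where \<alpha>: "\<alpha> \<in> I" "norm f - e / 2 / 4 < norm (apply_bcontfun f (x \<alpha>))"
        using norming_subset_exists_norm_gt[OF assms(3) _ f, of "e / 2 / 4"] I e by auto
      obtain n y where "1 \<le> n" and small: "norm ((\<phi> \<alpha> ^ n) \<otimes>\<^sub>C y) \<le> e / 2"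
        and loc: "localized (1 / real (Suc k)) (f + (\<phi> \<alpha> ^ n) \<otimes>\<^sub>C y)"
        using localized_peak_perturbation[OF assms(4)[OF \<alpha>(1)] \<alpha>(2) _ _ v, of "1 / real (Suc k)"] e
        by auto
      then have "f + (\<phi> \<alpha> ^ n) \<otimes>\<^sub>C y \<in> G k"
        using f assms(5)[OF \<alpha>(1)] complex_vector.subspace_add[OF assms(1)] by (simp add: G_def)
      moreover have "dist (f + (\<phi> \<alpha> ^ n) \<otimes>\<^sub>C y) f < e"
        using small e by (simp add: dist_norm)
      ultimately show "\<exists>g\<in>G k. dist g f < e" by blast
    qed
  qed
  \<comment> \<open>Baire is applied inside \<open>A\<close>, which is completely metrizable as a
    closed subset of a Banach space; the sets \<open>G k\<close> are open and dense relative to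
    \<open>A\<close>.\<close>
  have "top_of_set A closure_of \<Inter>(range G) = topspace (top_of_set A)"
  proof (rule Baire_category)
    have "completely_metrizable_space (top_of_set A)"
      using completely_metrizable_space_closedin[OF completely_metrizable_space_euclidean] assms(2)
      by simp
    then show "completely_metrizable_space (top_of_set A) \<or>
        locally_compact_space (top_of_set A) \<and> regular_space (top_of_set A)" ..
    fix T assume "T \<in> range G"
    then obtain k where T: "T = G k" by blast
    have "openin (top_of_set A) (G k)"
      unfolding G_def by (rule openin_open_Int[OF open_localized])
    moreover have "top_of_set A closure_of G k = A"
      using dense[of k] by (auto simp: closure_of_subtopology G_def Int_absorb1)
    ultimately show "openin (top_of_set A) T \<and> top_of_set A closure_of T = topspace (top_of_set A)"
      by (simp add: T)
  qed simp
  then have "A \<subseteq> closure (\<Inter>(range G))"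
    by (auto simp: closure_of_subtopology intro: subsetD[OF closure_mono[OF Int_lower2]])
  also have "\<dots> \<subseteq> closure {f \<in> A. norm_attaining f}"
    by (intro closure_mono) (auto simp: G_def intro: norm_attaining_if_localized)
  finally show ?thesis .
qed

end
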